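(* Let $\mathcal{C}$ be a non-degenerate $[n,k]_{q^m/q}$ code such that $\mathcal{C}^\perp$ is non-degenerate, let $U_{\mathcal{C}}$ be an associated system, and let $0<\varepsilon_{U_{\mathcal{C}}}(t_1)=\varepsilon_1<\dots<\varepsilon_{U_{\mathcal{C}}}(t_{s-1})=\varepsilon_{s-1}<\varepsilon_{U_{\mathcal{C}}}(k)=n-k$ be the sequence of maximum non-zero defects with respect to $U_{\mathcal{C}}$, and set $t_0=0$, $\varepsilon_0=0$, $t_s=k$, $\varepsilon_s=n-k$. Then: (1) for every $r\in\{1,\dots,k\}$, if $t_i\le k-r<t_{i+1}$, then $d_r(\mathcal{C})=n-(k-r)-\varepsilon_i$; consequently $\{n+1-d_r(\mathcal{C}):1\le r\le k\}=\bigcup_{i=0}^{s-1}I_i$ with $I_i=\{1+\varepsilon_i+t_i,2+\varepsilon_i+t_i,\dots,t_{i+1}+\varepsilon_i\}$; (2) for every $r\in\{1,\dots,n-k\}$, if $j\in[s]$ is such that $\varepsilon_{j-1}<r\le\varepsilon_j$, then $d_r(\mathcal{C}^\perp)=r+t_j$; consequently $\{d_r(\mathcal{C}^\perp):1\le r\le n-k\}=\bigcup_{j=1}^sJ_j$ with $J_j=\{1+\varepsilon_{j-1}+t_j,\dots,\varepsilon_j+t_j\}$; (3) $\{d_r(\mathcal{C}^\perp):1\le r\le n-k\}=\{1,\dots,n\}\setminus\{n+1-d_r(\mathcal{C}):1\le r\le k\}$.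
   Context: An $[n,k]_{q^m/q}$ code is a $k$-dim $\mathbb{F}_{q^m}$-subspace of $\mathbb{F}_{q^m}^n$ with the rank metric; $\mathcal{C}^\perp$ is the dual w.r.t. the standard bilinear form. Non-degenerate: columns of a generator matrix are $\mathbb{F}_q$-linearly independent. For non-degenerate $\mathcal{C}$ with generator matrix $G$, an associated system $U_{\mathcal{C}}\subseteq\mathbb{F}_{q^m}^k$ is the $\mathbb{F}_q$-span of the columns of $G$ (an $n$-dim $\mathbb{F}_q$-subspace spanning $\mathbb{F}_{q^m}^k$). The $r$-th generalized rank weight is $d_r(\mathcal{C})=n-\max\{\dim_{\mathbb{F}_q}(U_{\mathcal{C}}\cap T): T \text{ an } \mathbb{F}_{q^m}\text{-subspace of codimension } r \text{ in } \mathbb{F}_{q^m}^k\}$ (and similarly for $\mathcal{C}^\perp$ with $U_{\mathcal{C}^\perp}\subseteq\mathbb{F}_{q^m}^{n-k}$). For an $\mathbb{F}_q$-subspace $U$ of $\mathbb{F}_{q^m}^k$ and $\mathbb{F}_{q^m}$-subspace $T$: $\varepsilon_U(T)=\dim_{\mathbb{F}_q}(U\cap T)-\dim_{\mathbb{F}_{q^m}}T$; $\varepsilon_U(r)=\max\{\varepsilon_U(T):\dim T=r\}$. For $U$ of dimension $n$ spanning $\mathbb{F}_{q^m}^k$, $0=\varepsilon_U(0)\le\dots\le\varepsilon_U(k)=n-k$; if $\varepsilon_1<\dots<\varepsilon_s$ are the distinct positive values and $t_i=\min\{r:\varepsilon_U(r)=\varepsilon_i\}$, then $\varepsilon_U(t_1)<\dots<\varepsilon_U(t_s)$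 is the sequence of maximum non-zero defects. *)

theory Defs
  imports "HOL-Analysis.Analysis"
begin

text \<open>
  The extension of finite fields is a ring homomorphism \<open>emb\<close> from the small field
  \<open>'q\<close> (of order \<open>q\<close>) to the large field \<open>'a\<close> (of order \<open>q^m\<close>); it is automatically
  injective, and every extension of finite fields is of this form. Linear algebra over
  the large field is the library's \<open>vec\<close> interpretation; linear algebra over the small
  field is the same library development for the restricted scalar multiplication
  \<open>scaleq emb\<close>. The lengths and dimensions \<open>n\<close>, \<open>k\<close>, \<open>n - k\<close> are the
  cardinalities of finite index types.
\<close>

definition field_embedding :: "('q::field \<Rightarrow> 'a::field) \<Rightarrow> bool" where
  "field_embedding emb \<longleftrightarrow> emb 1 = 1 \<and> (\<forall>x y. emb (x + y) = emb x + emb y) \<and>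
     (\<forall>x y. emb (x * y) = emb x * emb y)"

definition scaleq :: "('q::field \<Rightarrow> 'a::field) \<Rightarrow> 'q \<Rightarrow> 'a ^ 'n \<Rightarrow> 'a ^ 'n" where
  "scaleq emb c v = emb c *s v"

abbreviation spanq :: "('q::field \<Rightarrow> 'a::field) \<Rightarrow> ('a ^ 'n) set \<Rightarrow> ('a ^ 'n) set" where
  "spanq emb \<equiv> module.span (scaleq emb)"

abbreviation dimq :: "('q::field \<Rightarrow> 'a::field) \<Rightarrow> ('a ^ 'n) set \<Rightarrow> nat" where
  "dimq emb \<equiv> vector_space.dim (scaleq emb)"

abbreviation dependentq :: "('q::field \<Rightarrow> 'a::field) \<Rightarrow> ('a ^ 'n) set \<Rightarrow> bool" where
  "dependentq emb \<equiv> module.dependent (scaleq emb)"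

definition linear_code :: "nat \<Rightarrow> nat \<Rightarrow> ('a::field ^ 'n::finite) set \<Rightarrow> bool" where
  "linear_code n k C \<longleftrightarrow> n = CARD('n) \<and> vec.subspace C \<and> vec.dim C = k"

definition dual_code :: "('a::field ^ 'n::finite) set \<Rightarrow> ('a ^ 'n) set" where
  "dual_code C = {y. \<forall>x\<in>C. (\<Sum>i\<in>UNIV. x $ i * y $ i) = 0}"

text \<open>The rows of a generator matrix form a basis of the code.\<close>

definition generator_matrix :: "('a::field ^ 'n::finite) set \<Rightarrow> 'a ^ 'n ^ 'k::finite \<Rightarrow> bool" where
  "generator_matrix C G \<longleftrightarrow>
     inj (\<lambda>i. row i G) \<and> vec.independent (rows G) \<and> vec.span (rows G) = C"

text \<open>
  The type argument \<open>'k\<close> below indexes the rows of the generator matrices of the code, so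
  it has as many elements as the dimension of the code. Injectivity of the column map is
  needed because \<open>columns G\<close> is a set and would hide repeated columns.
\<close>

definition nondegenerate ::
  "'k::finite itself \<Rightarrow> ('q::field \<Rightarrow> 'a::field) \<Rightarrow> ('a ^ 'n::finite) set \<Rightarrow> bool" where
  "nondegenerate _ emb C \<longleftrightarrow>
     (\<exists>G :: 'a ^ 'n ^ 'k. generator_matrix C G \<and>
        inj (\<lambda>j. column j G) \<and> \<not> dependentq emb (columns G))"

definition associated_system ::
  "('q::field \<Rightarrow> 'a::field) \<Rightarrow> ('a ^ 'n::finite) set \<Rightarrow> ('a ^ 'k::finite) set \<Rightarrow> bool" where
  "associated_system emb C U \<longleftrightarrow>
     (\<exists>G :: 'a ^ 'n ^ 'k. generator_matrix C G \<and> U = spanq emb (columns G))"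

text \<open>
  The generalized rank weights of a code do not depend on the associated system chosen
  in the following definition; see \<open>gen_rank_weight_eq\<close> below.
\<close>

definition gen_rank_weight ::
  "'k::finite itself \<Rightarrow> ('q::field \<Rightarrow> 'a::field) \<Rightarrow> ('a ^ 'n::finite) set \<Rightarrow> nat \<Rightarrow> nat" where
  "gen_rank_weight _ emb C r =
     (let U = (SOME U :: ('a ^ 'k) set. associated_system emb C U)
      in CARD('n) - Max {dimq emb (U \<inter> T) | T. vec.subspace T \<and> vec.dim T + r = CARD('k)})"

definition defect ::
  "('q::field \<Rightarrow> 'a::field) \<Rightarrow> ('a ^ 'k::finite) set \<Rightarrow> ('a ^ 'k) set \<Rightarrow> int" where
  "defect emb U T = int (dimq emb (U \<inter> T)) - int (vec.dim T)"

definition max_defect ::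
  "('q::field \<Rightarrow> 'a::field) \<Rightarrow> ('a ^ 'k::finite) set \<Rightarrow> nat \<Rightarrow> int" where
  "max_defect emb U r = Max {defect emb U T | T. vec.subspace T \<and> vec.dim T = r}"

text \<open>
  \<open>e 1 < \<dots> < e s\<close> are the distinct positive values of the maximum defects, attained for
  the first time at \<open>t 1, \<dots>, t s\<close>; the sequences are extended by \<open>t 0 = 0\<close>, \<open>e 0 = 0\<close>.
\<close>

definition max_defect_sequence ::
  "('q::field \<Rightarrow> 'a::field) \<Rightarrow> ('a ^ 'k::finite) set \<Rightarrow>
     nat \<Rightarrow> (nat \<Rightarrow> nat) \<Rightarrow> (nat \<Rightarrow> nat) \<Rightarrow> bool" where
  "max_defect_sequence emb U s t e \<longleftrightarrow>
     t 0 = 0 \<and> e 0 = 0 \<and> strict_mono_on {0..s} e \<and>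
     (\<lambda>i. int (e i)) ` {1..s} =
       {max_defect emb U r | r. r \<le> CARD('k) \<and> 0 < max_defect emb U r} \<and>
     (\<forall>i\<in>{1..s}. t i = (LEAST r. r \<le> CARD('k) \<and> max_defect emb U r = int (e i)))"

lemma vector_space_scaleq:
  assumes "field_embedding emb"
  shows "vector_space (scaleq emb :: 'q::field \<Rightarrow> 'a::field ^ 'n \<Rightarrow> 'a ^ 'n)"
  using assms
  by unfold_locales
    (auto simp: scaleq_def field_embedding_def vec_eq_iff algebra_simps)

lemma finite_dimensional_scaleq:
  assumes "field_embedding (emb :: 'q::field \<Rightarrow> 'a::{field,finite})"
  obtains B where
    "finite_dimensional_vector_space (scaleq emb :: 'q \<Rightarrow> 'a ^ 'n::finite \<Rightarrow> 'a ^ 'n) B"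
proof -
  interpret vector_space "scaleq emb :: 'q \<Rightarrow> 'a ^ 'n \<Rightarrow> 'a ^ 'n"
    by (rule vector_space_scaleq[OF assms])
  obtain B :: "('a ^ 'n) set" where "independent B" "UNIV \<subseteq> span B"
    using basis_exists[of UNIV] by blast
  then have "finite_dimensional_vector_space (scaleq emb :: 'q \<Rightarrow> 'a ^ 'n \<Rightarrow> 'a ^ 'n) B"
    by unfold_locales auto
  then show ?thesis by (rule that)
qed

lemma generator_matrix_right_inverse:
  fixes G :: "'a::field ^ 'n::finite ^ 'k::finite"
  assumes "generator_matrix C G"
  shows "\<exists>R :: 'a ^ 'k ^ 'n. G ** R = mat 1"
  unfolding matrix_right_invertible_independent_rows
proof (intro allI impI)
  fix c i
  assume *: "(\<Sum>i\<in>UNIV. c i *s row i G) = 0"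
  have inj: "inj (\<lambda>i. row i G)" and ind: "vec.independent (rows G)"
    using assms by (auto simp: generator_matrix_def)
  have rows: "rows G = range (\<lambda>i. row i G)" by (auto simp: rows_def)
  let ?u = "\<lambda>v. c (inv (\<lambda>i. row i G) v)"
  have "(\<Sum>v\<in>rows G. ?u v *s v) = 0"
    unfolding rows using * by (simp add: sum.reindex[OF inj] inv_f_f[OF inj])
  then have "?u (row i G) = 0"
    using ind vec.independentD[of "rows G" "rows G" ?u "row i G"]
    by (auto simp: rows)
  then show "c i = 0" by (simp add: inv_f_f[OF inj])
qed

lemma generator_matrix_change:
  fixes G G' :: "'a::field ^ 'n::finite ^ 'k::finite"
  assumes "generator_matrix C G" "generator_matrix C G'"
  shows "\<exists>A. invertible A \<and> G' = A ** G"
proof -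
  have rows: "rows G = range (\<lambda>i. row i G)" by (auto simp: rows_def)
  have inj: "inj (\<lambda>i. row i G)" using assms by (auto simp: generator_matrix_def)
  have "\<exists>a. row i G' = (\<Sum>j\<in>UNIV. a j *s row j G)" for i
  proof -
    have "row i G' \<in> vec.span (rows G)"
      using assms vec.span_superset[of "rows G'"] by (auto simp: generator_matrix_def rows_def)
    then obtain u where "row i G' = (\<Sum>v\<in>rows G. u v *s v)"
      by (auto simp: vec.span_finite rows)
    then have "row i G' = (\<Sum>j\<in>UNIV. u (row j G) *s row j G)"
      unfolding rows by (simp add: sum.reindex[OF inj])
    then show ?thesis by (intro exI)
  qed
  then obtain a where a: "\<And>i. row i G' = (\<Sum>j\<in>UNIV. a i j *s row j G)" by metis
  define A where "A = (\<chi> i j. a i j)"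
  have "G' $ i $ l = (A ** G) $ i $ l" for i l
    using arg_cong[OF a[of i], of "\<lambda>v. v $ l"]
    by (simp add: A_def matrix_matrix_mult_def row_def)
  then have eq: "G' = A ** G" by (simp add: vec_eq_iff)
  obtain R where "G' ** R = mat 1"
    using generator_matrix_right_inverse[OF assms(2)] by blast
  then have "A ** (G ** R) = mat 1" by (simp add: eq matrix_mul_assoc)
  then have "invertible A" by (auto simp: invertible_right_inverse)
  with eq show ?thesis by blast
qed

lemma associated_system_dims_subset:
  fixes emb :: "'q::field \<Rightarrow> 'a::{field,finite}"
    and U U' :: "('a ^ 'k::finite) set" and C :: "('a ^ 'n::finite) set"
  assumes emb: "field_embedding emb"
    and "associated_system emb C U" "associated_system emb C U'"
  shows "{dimq emb (U \<inter> T) | T. vec.subspace T \<and> vec.dim T + r = CARD('k)}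
       \<subseteq> {dimq emb (U' \<inter> T) | T. vec.subspace T \<and> vec.dim T + r = CARD('k)}"
proof -
  obtain G G' :: "'a ^ 'n ^ 'k" where G: "generator_matrix C G" "U = spanq emb (columns G)"
    and G': "generator_matrix C G'" "U' = spanq emb (columns G')"
    using assms by (auto simp: associated_system_def)
  obtain A where inv: "invertible A" and A: "G' = A ** G"
    using generator_matrix_change[OF G(1) G'(1)] by blast
  have inj: "inj ((*v) A)" using inv by (simp add: inj_matrix_vector_mult)
  obtain B where "finite_dimensional_vector_space (scaleq emb :: 'q \<Rightarrow> 'a ^ 'k \<Rightarrow> 'a ^ 'k) B"
    using finite_dimensional_scaleq[OF emb] by blast
  then interpret Q: finite_dimensional_vector_space "scaleq emb :: 'q \<Rightarrow> 'a ^ 'k \<Rightarrow> 'a ^ 'k" B .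
  interpret P: finite_dimensional_vector_space_pair
    "scaleq emb :: 'q \<Rightarrow> 'a ^ 'k \<Rightarrow> 'a ^ 'k" B "scaleq emb :: 'q \<Rightarrow> 'a ^ 'k \<Rightarrow> 'a ^ 'k" B ..
  have lin: "Vector_Spaces.linear (scaleq emb) (scaleq emb) ((*v) A)"
    by unfold_locales
      (auto simp: scaleq_def matrix_vector_right_distrib vector_scalar_commute)
  have "column j G' = A *v column j G" for j
    by (simp add: A column_def matrix_matrix_mult_def matrix_vector_mult_def vec_eq_iff)
  then have "columns G' = (*v) A ` columns G"
    by (auto simp: columns_def)
  then have U': "U' = (*v) A ` U"
    by (simp add: G G' P.linear_span_image[OF lin])
  show ?thesis
  proof clarify
    fix T :: "('a ^ 'k) set"
    assume T: "vec.subspace T" "vec.dim T + r = CARD('k)"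
    have "vec.subspace ((*v) A ` T)"
      using T(1) by (rule vec.subspace_image)
    moreover have "vec.dim ((*v) A ` T) = vec.dim T"
      by (rule vec.dim_image_eq) (use inj in \<open>auto intro: inj_on_subset\<close>)
    moreover have "U' \<inter> (*v) A ` T = (*v) A ` (U \<inter> T)"
      using inj by (simp add: U' image_Int)
    moreover have "dimq emb ((*v) A ` (U \<inter> T)) = dimq emb (U \<inter> T)"
      by (rule P.dim_image_eq[OF lin]) (use inj in \<open>auto intro: inj_on_subset\<close>)
    ultimately show "\<exists>T'. dimq emb (U \<inter> T) = dimq emb (U' \<inter> T') \<and>
        vec.subspace T' \<and> vec.dim T' + r = CARD('k)"
      using T(2) by metis
  qed
qed

lemma gen_rank_weight_eq:
  fixes emb :: "'q::field \<Rightarrow> 'a::{field,finite}"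
    and U :: "('a ^ 'k::finite) set" and C :: "('a ^ 'n::finite) set"
  assumes "field_embedding emb" "associated_system emb C U"
  shows "gen_rank_weight TYPE('k) emb C r =
    CARD('n) - Max {dimq emb (U \<inter> T) | T. vec.subspace T \<and> vec.dim T + r = CARD('k)}"
proof -
  define U' where "U' = (SOME U :: ('a ^ 'k) set. associated_system emb C U)"
  have "associated_system emb C U'"
    unfolding U'_def using assms(2) by (rule someI)
  then have "{dimq emb (U \<inter> T) | T. vec.subspace T \<and> vec.dim T + r = CARD('k)}
       = {dimq emb (U' \<inter> T) | T. vec.subspace T \<and> vec.dim T + r = CARD('k)}"
    using assms by (intro subset_antisym associated_system_dims_subset)
  then show ?thesis
    by (simp add: gen_rank_weight_def Let_def U'_def)
qed

end

theory Submission
  imports Defs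
begin

text \<open>
  The columns of a generator matrix \<open>G\<close> identify \<open>U\<close> with \<open>F_q^n\<close>. For an \<open>F_q\<close>-subspace
  \<open>W\<close> of \<open>F_q^n\<close> let \<open>\<rho>(W)\<close> be the \<open>F_{q^m}\<close>-dimension of the span of the image of \<open>W\<close> in
  \<open>F_{q^m}^k\<close>. Then \<open>max dim (U \<inter> T)\<close> over the \<open>T\<close> of dimension \<open>a\<close> is
  \<open>F(a) = max {dim W | \<rho>(W) \<le> a}\<close>, so that \<open>\<epsilon>_U(a) = F(a) - a\<close>. Rank-nullity and
  orthogonality show that the function \<open>\<rho>'\<close> of the dual code satisfies
  \<open>\<rho>'(W) + k = dim W + \<rho>(W\<^sup>\<bottom>)\<close>. Hence
  \<open>d_r(C\<^sup>\<bottom>) = min {dim V | dim V - \<rho>(V) \<ge> r}\<close>, which is \<open>r + t\<close> for the least \<open>t\<close> with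
  \<open>\<epsilon>_U(t) \<ge> r\<close>. That \<open>t_s = k\<close> is the case \<open>r = n - k\<close>, because non-degeneracy of the dual code
  means that \<open>\<rho>'\<close> vanishes only on the zero space.
\<close>

section \<open>Bases and rank-nullity\<close>

lemma extended_basis_exists:
  fixes X :: "('a::field ^ 'n::finite) set"
  obtains B B' where "B \<subseteq> X" "X \<subseteq> vec.span B" "card B = vec.dim X" "B \<subseteq> B'"
    "vec.independent B'" "UNIV \<subseteq> vec.span B'" "finite B'" "card B' = CARD('n)"
proof -
  obtain B where B: "B \<subseteq> X" "vec.independent B" "X \<subseteq> vec.span B" "card B = vec.dim X"
    using vec.basis_exists by blast
  obtain B' where B': "B \<subseteq> B'" "vec.independent B'" "UNIV \<subseteq> vec.span B'"
    using vec.maximal_independent_subset_extend[OF subset_UNIV B(2)] by metis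
  have "finite B'" "card B' = CARD('n)"
    using B' vec.finiteI_independent vec.basis_card_eq_dim[of B' UNIV] by (auto simp: card_cart_basis)
  with B B' show ?thesis by (intro that)
qed

text \<open>A linear right inverse \<open>g\<close> of \<open>A\<close> on the image of
  \<open>X\<close> embeds that image in \<open>X\<close> as a complement of the kernel: each
  \<open>z\<close> splits as \<open>z - g (A *v z)\<close> plus \<open>g (A *v z)\<close>.\<close>

lemma dim_matrix_image_kernel:
  fixes A :: "'a::field ^ 'n::finite ^ 'k::finite"
  assumes X: "vec.subspace X"
  shows "vec.dim ((*v) A ` X) + vec.dim {x \<in> X. A *v x = 0} = vec.dim X"
proof -
  let ?K = "{x \<in> X. A *v x = 0}"
  obtain g where g: "range g \<subseteq> X" "Vector_Spaces.linear (*s) (*s) g"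
      "\<And>v. v \<in> (*v) A ` X \<Longrightarrow> A *v g v = v"
    using vec.linear_exists_right_inverse_on[OF matrix_vector_mul_linear_gen[of A] X] by blast
  interpret g: Vector_Spaces.linear "(*s)" "(*s)" g by (rule g(2))
  let ?Y = "g ` (*v) A ` X"
  have K: "vec.subspace ?K"
    using X by (auto simp: vec.subspace_def matrix_vector_right_distrib vector_scalar_commute)
  have Y: "vec.subspace ?Y"
    by (intro g.subspace_image vec.subspace_image X)
  have "inj_on g ((*v) A ` X)" by (rule inj_on_inverseI[of _ "(*v) A"]) (rule g(3))
  \<comment> \<open>\<open>vec.dim_image_eq\<close> wants injectivity on the span, which for a
    subspace is the set itself.\<close>
  then have dimY: "vec.dim ?Y = vec.dim ((*v) A ` X)"
    using vec.span_eq_iff[THEN iffD2, OF vec.subspace_image[OF X, of A]]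
    by (intro vec.dim_image_eq[OF g(2)]) (simp only:)
  have "{x + y |x y. x \<in> ?K \<and> y \<in> ?Y} = X"
  proof (intro subset_antisym subsetI)
    fix z assume z: "z \<in> X"
    then have "z - g (A *v z) \<in> ?K"
      using g(1,3) X by (auto simp: matrix_vector_mult_diff_distrib intro: vec.subspace_diff)
    then show "z \<in> {x + y |x y. x \<in> ?K \<and> y \<in> ?Y}"
      using z by (force intro: exI[of _ "z - g (A *v z)"])
  qed (use g(1) X in \<open>auto intro: vec.subspace_add\<close>)
  moreover have "?K \<inter> ?Y = {0}"
    using g(1,3) vec.subspace_0[OF K] vec.subspace_0[OF Y] by (fastforce simp: g.zero)
  ultimately show ?thesis
    using vec.dim_sums_Int[OF K Y] dimY by (simp add: vec.dim_eq_0)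
qed

section \<open>Orthogonality for the standard bilinear form\<close>

lemma subspace_dual_code: "vec.subspace (dual_code X)"
  by (auto simp: vec.subspace_def dual_code_def distrib_left sum.distrib sum_distrib_left
      mult.left_commute simp flip: sum_distrib_left)

lemma dual_code_span: "dual_code (vec.span S) = dual_code S"
proof
  show "dual_code S \<subseteq> dual_code (vec.span S)"
  proof
    fix y assume y: "y \<in> dual_code S"
    have "vec.subspace {x. (\<Sum>i\<in>UNIV. x $ i * y $ i) = 0}"
      by (auto simp: vec.subspace_def distrib_right sum.distrib mult.assoc simp flip: sum_distrib_left)
    then show "y \<in> dual_code (vec.span S)"
      using y vec.span_minimal[of S "{x. (\<Sum>i\<in>UNIV. x $ i * y $ i) = 0}"]
      by (auto simp: dual_code_def)
  qed
qed (use vec.span_superset in \<open>auto simp: dual_code_def\<close>)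

text \<open>A basis of \<open>X\<close>, extended to the whole space, gives the rows of an
  invertible matrix \<open>M\<close>. Multiplication by \<open>M\<close> maps the dual code onto a
  coordinate subspace: the vectors that vanish at every row taken from the basis of
  \<open>X\<close>.\<close>

lemma dim_dual_code:
  fixes X :: "('a::field ^ 'n::finite) set"
  shows "vec.dim (dual_code X) + vec.dim X = CARD('n)"
proof -
  obtain B B' where B: "B \<subseteq> X" "X \<subseteq> vec.span B" "card B = vec.dim X"
    and B': "B \<subseteq> B'" "vec.independent B'" "UNIV \<subseteq> vec.span B'"
    and fin: "finite B'" and card: "card B' = CARD('n)"
    by (rule extended_basis_exists)
  obtain h where h: "bij_betw h (UNIV :: 'n set) B'"
    using finite_same_card_bij[of "UNIV :: 'n set" B'] fin card by auto
  define M :: "'a ^ 'n ^ 'n" where "M = (\<chi> i. h i)"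
  have row: "row i M = h i" for i by (simp add: row_def M_def)
  have "rows M = B'" using h by (auto simp: rows_def row bij_betw_def)
  \<comment> \<open>Viewed as a generator matrix of the whole space, \<open>M\<close> gets its right
    inverse from \<open>generator_matrix_right_inverse\<close>.\<close>
  then have "generator_matrix UNIV M"
    using h B' by (auto simp: generator_matrix_def row bij_betw_def)
  then have "invertible M"
    using generator_matrix_right_inverse by (auto simp: invertible_right_inverse)
  then have bij: "bij ((*v) M)"
    by (metis bij_def inj_matrix_vector_mult invertible_def matrix_right_invertible_surjective)
  have dual: "dual_code X = dual_code B"
    using B by (metis dual_code_span subset_antisym vec.span_mono vec.span_span)
  define d where "d = {i. h i \<notin> B}"
  have comp: "(M *v y) $ i = (\<Sum>j\<in>UNIV. h i $ j * y $ j)" for y i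
    by (simp add: M_def matrix_vector_mult_def)
  have "y \<in> dual_code X \<longleftrightarrow> (\<forall>i. i \<notin> d \<longrightarrow> (M *v y) $ i = 0)" for y
    unfolding dual comp using h B'(1) by (fastforce simp: d_def dual_code_def bij_betw_def)
  then have "(*v) M ` dual_code X = {z. \<forall>i. i \<notin> d \<longrightarrow> z $ i = 0}"
    using bij by (auto simp: bij_def image_iff) (metis surjD)
  then have "vec.dim (dual_code X) = card d"
    using vec.dim_image_eq[OF matrix_vector_mul_linear_gen[of M] inj_on_subset[OF bij_is_inj[OF bij] subset_UNIV],
        of "dual_code X"]
    by (simp add: dim_substandard_cart)
  moreover have "bij_betw h d (B' - B)"
    using h by (auto simp: bij_betw_def d_def inj_on_def image_iff)
  then have "card d = card B' - card B"
    using bij_betw_same_card card_Diff_subset finite_subset[OF B'(1) fin] B'(1) by metis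
  ultimately show ?thesis
    using B(3) card card_mono[OF fin B'(1)] by simp
qed

text \<open>The form may have isotropic vectors, so \<open>X\<close> and its dual need not be
  complements. Equality comes from the evident inclusion by counting dimensions twice.\<close>

lemma dual_dual_code:
  assumes "vec.subspace X"
  shows "dual_code (dual_code X) = X"
proof -
  have "X \<subseteq> dual_code (dual_code X)" by (auto simp: dual_code_def mult.commute)
  then show ?thesis
    using vec.subspace_dim_equal[OF assms subspace_dual_code]
      dim_dual_code[of X] dim_dual_code[of "dual_code X"] by fastforce
qed

lemma dual_code_sums:
  assumes "vec.subspace X" "vec.subspace Y"
  shows "dual_code {x + y |x y. x \<in> X \<and> y \<in> Y} = dual_code X \<inter> dual_code Y"
proof -
  have "X \<union> Y \<subseteq> {x + y |x y. x \<in> X \<and> y \<in> Y}"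
    using assms by (force dest: vec.subspace_0)
  then have "dual_code {x + y |x y. x \<in> X \<and> y \<in> Y} \<subseteq> dual_code X \<inter> dual_code Y"
    unfolding dual_code_def by blast
  moreover have "dual_code X \<inter> dual_code Y \<subseteq> dual_code {x + y |x y. x \<in> X \<and> y \<in> Y}"
    by (auto simp: dual_code_def distrib_right sum.distrib)
  ultimately show ?thesis by (rule subset_antisym)
qed

lemma generator_matrix_kernel:
  assumes "generator_matrix C G"
  shows "{x. G *v x = 0} = dual_code C"
proof -
  have "dual_code C = dual_code (rows G)"
    using assms dual_code_span by (auto simp: generator_matrix_def)
  then show ?thesis
    by (auto simp: dual_code_def rows_def row_def matrix_vector_mult_def vec_eq_iff)
qed

section \<open>Extension of scalars from the small to the large field\<close>

text \<open>The small field is a type of its own, so this map takes the place of the inclusion of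
  \<open>F_q^n\<close> in \<open>F_{q^m}^n\<close>.\<close>

definition emb_vec :: "('q \<Rightarrow> 'a) \<Rightarrow> 'q ^ 'n \<Rightarrow> 'a ^ 'n" where
  "emb_vec emb x = (\<chi> i. emb (x $ i))"

lemma field_embedding_simps:
  assumes "field_embedding emb"
  shows "emb 0 = 0" "emb 1 = 1" "emb (x + y) = emb x + emb y" "emb (x * y) = emb x * emb y"
    "emb (sum f S) = (\<Sum>i\<in>S. emb (f i))"
proof -
  have add: "emb (x + y) = emb x + emb y" for x y using assms by (simp add: field_embedding_def)
  have zero: "emb 0 = 0" using add[of 0 0] by (metis add.right_neutral add_left_cancel)
  show "emb 0 = 0" "emb (x + y) = emb x + emb y" by (fact zero add)+
  show "emb 1 = 1" "emb (x * y) = emb x * emb y" using assms by (auto simp: field_embedding_def)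
  show "emb (sum f S) = (\<Sum>i\<in>S. emb (f i))"
    by (induction S rule: infinite_finite_induct) (auto simp: zero add)
qed

lemma emb_vec_add: "field_embedding emb \<Longrightarrow> emb_vec emb (x + y) = emb_vec emb x + emb_vec emb y"
  and emb_vec_scale: "field_embedding emb \<Longrightarrow> emb_vec emb (c *s x) = emb c *s emb_vec emb x"
  and emb_vec_0: "field_embedding emb \<Longrightarrow> emb_vec emb 0 = 0"
  and emb_vec_axis: "field_embedding emb \<Longrightarrow> emb_vec emb (axis i 1) = axis i 1"
  by (auto simp: emb_vec_def vec_eq_iff axis_def field_embedding_simps)

lemma emb_vec_span:
  assumes "field_embedding emb"
  shows "emb_vec emb ` vec.span S \<subseteq> vec.span (emb_vec emb ` S)"
proof -
  have "vec.subspace {x. emb_vec emb x \<in> vec.span (emb_vec emb ` S)}"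
    by (auto simp: vec.subspace_def emb_vec_add[OF assms] emb_vec_scale[OF assms] emb_vec_0[OF assms]
        vec.span_zero vec.span_add vec.span_scale)
  then have "vec.span S \<subseteq> {x. emb_vec emb x \<in> vec.span (emb_vec emb ` S)}"
    by (intro vec.span_minimal) (auto intro: vec.span_base)
  then show ?thesis by auto
qed

text \<open>The standard basis is defined over the small field, so the image of a basis of
  \<open>F_q^n\<close> spans \<open>F_{q^m}^n\<close>. Having at most \<open>n\<close> elements, it
  is a basis there too, and the part of it that comes from \<open>W\<close> stays
  independent.\<close>

lemma dim_emb_vec_image:
  fixes emb :: "'q::field \<Rightarrow> 'a::field" and W :: "('q ^ 'n::finite) set"
  assumes emb: "field_embedding emb"
  shows "vec.dim (emb_vec emb ` W) = vec.dim W"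
proof -
  obtain B B' where B: "B \<subseteq> W" "W \<subseteq> vec.span B" "card B = vec.dim W"
    and B': "B \<subseteq> B'" "vec.independent B'" "UNIV \<subseteq> vec.span B'"
    and fin: "finite B'" and card: "card B' = CARD('n)"
    by (rule extended_basis_exists)
  have "cart_basis \<subseteq> emb_vec emb ` UNIV"
    by (auto simp: cart_basis_def image_iff) (metis emb emb_vec_axis)
  also have "\<dots> \<subseteq> vec.span (emb_vec emb ` B')"
    using emb_vec_span[OF emb, of B'] B'(3) by blast
  finally have span: "UNIV \<subseteq> vec.span (emb_vec emb ` B')"
    by (metis span_cart_basis vec.span_mono vec.span_span)
  have le: "card (emb_vec emb ` B') \<le> CARD('n)"
    using card_image_le[OF fin] card by metis
  have ind': "vec.independent (emb_vec emb ` B')"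
    by (rule vec.card_le_dim_spanning[OF _ span]) (use fin le in \<open>auto simp: card_cart_basis\<close>)
  then have "card (emb_vec emb ` B') = card B'"
    using span vec.basis_card_eq_dim[of "emb_vec emb ` B'" UNIV] card by (auto simp: card_cart_basis)
  then have "inj_on (emb_vec emb) B'"
    using fin eq_card_imp_inj_on by blast
  then have "card (emb_vec emb ` B) = card B"
    using B'(1) by (meson card_image inj_on_subset)
  moreover have "vec.independent (emb_vec emb ` B)"
    using ind' B'(1) by (meson image_mono vec.independent_mono)
  moreover have "emb_vec emb ` W \<subseteq> vec.span (emb_vec emb ` B)"
    using emb_vec_span[OF emb, of B] B(2) by blast
  ultimately show ?thesis
    using B by (metis image_mono vec.basis_card_eq_dim)
qed

text \<open>The embedding preserves the bilinear form, which gives one inclusion. Both sides have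
  dimension \<open>n - dim W\<close>, since extension of scalars preserves dimensions.\<close>

lemma dual_code_emb_vec:
  fixes emb :: "'q::field \<Rightarrow> 'a::field" and W :: "('q ^ 'n::finite) set"
  assumes emb: "field_embedding emb"
  shows "vec.span (emb_vec emb ` dual_code W) = dual_code (emb_vec emb ` W)"
proof (rule vec.subspace_dim_equal)
  have "emb_vec emb ` dual_code W \<subseteq> dual_code (emb_vec emb ` W)"
    by (auto simp: dual_code_def emb_vec_def
        simp flip: field_embedding_simps(4,5)[OF emb])
      (simp add: field_embedding_simps(1)[OF emb])
  then show "vec.span (emb_vec emb ` dual_code W) \<subseteq> dual_code (emb_vec emb ` W)"
    by (intro vec.span_minimal subspace_dual_code)
  show "vec.dim (dual_code (emb_vec emb ` W)) \<le> vec.dim (vec.span (emb_vec emb ` dual_code W))"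
    using dim_dual_code[of "emb_vec emb ` W"] dim_dual_code[of W]
    by (simp add: dim_emb_vec_image[OF emb])
qed (auto intro: subspace_dual_code)

section \<open>The associated system as an image of \<open>F_q^n\<close>, and its rank
  function\<close>

definition column_map :: "('q \<Rightarrow> 'a::field) \<Rightarrow> 'a ^ 'n::finite ^ 'k::finite \<Rightarrow> 'q ^ 'n \<Rightarrow> 'a ^ 'k" where
  "column_map emb G x = G *v emb_vec emb x"

text \<open>This is \<rho>, the rank function of the q-matroid that \<open>G\<close> represents. The
  image of \<open>W\<close> need not be a subspace over the large field; \<open>vec.dim\<close> of
  it is the dimension of its span.\<close>

definition rankq :: "('q \<Rightarrow> 'a::field) \<Rightarrow> 'a ^ 'n::finite ^ 'k::finite \<Rightarrow> ('q ^ 'n) set \<Rightarrow> nat" where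
  "rankq emb G W = vec.dim (column_map emb G ` W)"

text \<open>Rank-nullity for \<open>G\<close> on the scalar extension of \<open>W\<close>; the
  kernel of \<open>G\<close> is the dual code.\<close>

lemma rankq_dual_Int:
  assumes emb: "field_embedding emb" and G: "generator_matrix C G"
  shows "rankq emb G W + vec.dim (vec.span (emb_vec emb ` W) \<inter> dual_code C) = vec.dim W"
proof -
  let ?X = "vec.span (emb_vec emb ` W)"
  have "column_map emb G ` W = (*v) G ` emb_vec emb ` W"
    by (auto simp: column_map_def)
  then have "rankq emb G W = vec.dim ((*v) G ` ?X)"
    by (simp add: rankq_def flip: vec.span_image)
  moreover have "{x \<in> ?X. G *v x = 0} = ?X \<inter> dual_code C"
    using generator_matrix_kernel[OF G] by blast
  ultimately show ?thesis
    using dim_matrix_image_kernel[of ?X G] by (simp add: dim_emb_vec_image[OF emb])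
qed

text \<open>This is the rank formula of the dual q-matroid. \<open>rankq_dual_Int\<close> is applied
  to the dual of \<open>W\<close> with \<open>C\<close> and to \<open>W\<close> with the dual of
  \<open>C\<close>. The two intersections that arise are the dual of \<open>?S\<close> and
  \<open>?X \<inter> C\<close>, and their dimensions are linked by the dimension formula for the sum
  \<open>?S\<close>.\<close>

lemma rankq_dual:
  fixes emb :: "'q::field \<Rightarrow> 'a::field" and C :: "('a ^ 'n::finite) set"
  assumes emb: "field_embedding emb" and G: "generator_matrix C G"
    and H: "generator_matrix (dual_code C) H"
  shows "rankq emb H W + vec.dim C = vec.dim W + rankq emb G (dual_code W)"
proof -
  let ?X = "vec.span (emb_vec emb ` W)"
  let ?S = "{x + y |x y. x \<in> ?X \<and> y \<in> C}"
  have C: "vec.subspace C" using G by (auto simp: generator_matrix_def)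
  have "vec.span (emb_vec emb ` dual_code W) \<inter> dual_code C = dual_code ?S"
    by (simp add: dual_code_sums C dual_code_span dual_code_emb_vec[OF emb])
  then have "rankq emb G (dual_code W) + vec.dim (dual_code ?S) = vec.dim (dual_code W)"
    using rankq_dual_Int[OF emb G, of "dual_code W"] by simp
  moreover have "rankq emb H W + vec.dim (?X \<inter> C) = vec.dim W"
    using rankq_dual_Int[OF emb H, of W] by (simp add: dual_dual_code C)
  moreover have "vec.dim ?S + vec.dim (?X \<inter> C) = vec.dim W + vec.dim C"
    using vec.dim_sums_Int[of ?X C] C by (simp add: dim_emb_vec_image[OF emb])
  ultimately show ?thesis
    using dim_dual_code[of ?S] dim_dual_code[of W] by linarith
qed

lemma linear_column_map:
  assumes "field_embedding emb"
  shows "Vector_Spaces.linear (*s) (scaleq emb) (column_map emb G)"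
proof -
  interpret vector_space "scaleq emb" by (rule vector_space_scaleq[OF assms])
  show ?thesis
    by unfold_locales
      (auto simp: column_map_def scaleq_def emb_vec_add[OF assms] emb_vec_scale[OF assms]
        matrix_vector_right_distrib vector_scalar_commute)
qed

lemma column_map_eq_sum:
  "column_map emb G x = (\<Sum>j\<in>UNIV. scaleq emb (x $ j) (column j G))"
  by (simp add: column_map_def matrix_mult_sum emb_vec_def scaleq_def)

lemma spanq_columns:
  fixes G :: "'a::field ^ 'n::finite ^ 'k::finite"
  assumes emb: "field_embedding emb"
  shows "spanq emb (columns G) = range (column_map emb G)"
proof -
  interpret vector_space "scaleq emb :: _ \<Rightarrow> 'a ^ 'k \<Rightarrow> _" by (rule vector_space_scaleq[OF emb])
  interpret L: Vector_Spaces.linear "(*s)" "scaleq emb" "column_map emb G"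
    by (rule linear_column_map[OF emb])
  show ?thesis
  proof
    have "column j G = column_map emb G (axis j 1)" for j
      unfolding column_map_def emb_vec_axis[OF emb]
      by (simp add: column_def matrix_vector_mult_def axis_def if_distrib vec_eq_iff cong: if_cong)
    then have "columns G \<subseteq> range (column_map emb G)" by (auto simp: columns_def)
    then show "span (columns G) \<subseteq> range (column_map emb G)"
      by (intro span_minimal L.subspace_image vec.subspace_UNIV)
    show "range (column_map emb G) \<subseteq> span (columns G)"
    proof
      fix y assume "y \<in> range (column_map emb G)"
      then obtain x where "y = (\<Sum>j\<in>UNIV. scaleq emb (x $ j) (column j G))"
        by (auto simp: column_map_eq_sum)
      moreover have "column j G \<in> span (columns G)" for j
        by (rule span_base) (auto simp: columns_def)
      ultimately show "y \<in> span (columns G)" by (simp add: span_sum span_scale)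
    qed
  qed
qed

lemma inj_column_map:
  fixes G :: "'a::field ^ 'n::finite ^ 'k::finite"
  assumes emb: "field_embedding emb" and inj: "inj (\<lambda>j. column j G)"
    and ind: "\<not> dependentq emb (columns G)"
  shows "inj (column_map emb G)"
proof -
  interpret vector_space "scaleq emb :: _ \<Rightarrow> 'a ^ 'k \<Rightarrow> _" by (rule vector_space_scaleq[OF emb])
  interpret L: Vector_Spaces.linear "(*s)" "scaleq emb" "column_map emb G"
    by (rule linear_column_map[OF emb])
  have cols: "columns G = range (\<lambda>j. column j G)" by (auto simp: columns_def)
  have "x = 0" if "column_map emb G x = 0" for x
  proof -
    \<comment> \<open>Since the columns are distinct, coefficients indexed by positions can be read
      as coefficients on the set of columns.\<close>
    let ?u = "\<lambda>v. x $ inv (\<lambda>j. column j G) v"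
    have "(\<Sum>v\<in>columns G. scaleq emb (?u v) v) = 0"
      using that by (simp add: cols column_map_eq_sum sum.reindex[OF inj] inv_f_f[OF inj])
    then have "?u (column j G) = 0" for j
      using ind independentD[of "columns G" "columns G" ?u "column j G"] by (auto simp: cols)
    then show ?thesis by (simp add: inv_f_f[OF inj] vec_eq_iff)
  qed
  then show ?thesis by (simp add: L.inj_iff_eq_0)
qed

text \<open>Non-degeneracy speaks of some generator matrix; an invertible change of basis carries
  injectivity over to every other one.\<close>

lemma nondegenerate_inj_column_map:
  fixes G :: "'a::field ^ 'n::finite ^ 'k::finite"
  assumes emb: "field_embedding emb" and "nondegenerate TYPE('k) emb C" and G: "generator_matrix C G"
  shows "inj (column_map emb G)"
proof -
  obtain G0 :: "'a ^ 'n ^ 'k" where G0: "generator_matrix C G0" and inj: "inj (column_map emb G0)"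
    using assms inj_column_map by (auto simp: nondegenerate_def)
  obtain A where A: "invertible A" "G = A ** G0"
    using generator_matrix_change[OF G0 G] by blast
  have "column_map emb G = (*v) A \<circ> column_map emb G0"
    by (auto simp: column_map_def A matrix_vector_mul_assoc)
  then show ?thesis
    using inj A(1) by (simp add: inj_compose inj_matrix_vector_mult)
qed

section \<open>Maximal dimensions, rank weights and defects\<close>

text \<open>Serves to pass from a space of rank at most \<open>a\<close> to a \<open>T\<close> of
  dimension exactly \<open>a\<close>, as the weights and defects demand.\<close>

lemma exists_superspace_dim:
  fixes S :: "('a::field ^ 'k::finite) set"
  assumes "vec.dim S \<le> a" "a \<le> CARD('k)"
  obtains T where "vec.subspace T" "S \<subseteq> T" "vec.dim T = a"
proof -
  obtain B B' where B: "B \<subseteq> S" "S \<subseteq> vec.span B" "card B = vec.dim S"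
    and B': "B \<subseteq> B'" "vec.independent B'" "UNIV \<subseteq> vec.span B'"
    and fin: "finite B'" and card: "card B' = CARD('k)"
    by (rule extended_basis_exists)
  obtain D where D: "B \<subseteq> D" "D \<subseteq> B'" "card D = a"
    using exists_subset_between[of B a B'] assms B(3) card B'(1) fin by metis
  have "vec.independent D" using B'(2) D(2) by (rule vec.independent_mono)
  then have "vec.dim (vec.span D) = a" using D(3) vec.dim_span_eq_card_independent by metis
  moreover have "S \<subseteq> vec.span D" using B(2) D(1) vec.span_mono by blast
  ultimately show ?thesis using that by blast
qed

text \<open>This is the function \<open>F\<close>. Bounding the rank by \<open>a\<close> instead of
  fixing it keeps the set nonempty for every \<open>a\<close>.\<close>

definition max_dim :: "('q::field \<Rightarrow> 'a::field) \<Rightarrow> 'a ^ 'n::finite ^ 'k::finite \<Rightarrow> nat \<Rightarrow> nat" where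
  "max_dim emb G a = Max {vec.dim W | W. vec.subspace W \<and> rankq emb G W \<le> a}"

lemma dim_le_card_index: "vec.dim (W :: ('a::field ^ 'n::finite) set) \<le> CARD('n)"
  using vec.dim_subset_UNIV[of W] by (simp add: vec.dimension_def card_cart_basis)

lemma
  fixes emb :: "'q::field \<Rightarrow> 'a::field" and G :: "'a ^ 'n::finite ^ 'k::finite"
  assumes emb: "field_embedding emb"
  shows max_dim_ge: "vec.subspace W \<Longrightarrow> rankq emb G W \<le> a \<Longrightarrow> vec.dim W \<le> max_dim emb G a"
    and max_dim_attained: "\<exists>W. vec.subspace W \<and> rankq emb G W \<le> a \<and> vec.dim W = max_dim emb G a"
proof -
  let ?S = "{vec.dim W | W. vec.subspace W \<and> rankq emb G W \<le> a}"
  have fin: "finite ?S"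
    by (rule finite_subset[of _ "{..CARD('n)}"]) (auto simp: dim_le_card_index)
  then show "vec.subspace W \<Longrightarrow> rankq emb G W \<le> a \<Longrightarrow> vec.dim W \<le> max_dim emb G a"
    unfolding max_dim_def by (intro Max_ge) auto
  have "rankq emb G {0} \<le> a"
    by (simp add: rankq_def column_map_def emb_vec_0[OF emb])
  then have "?S \<noteq> {}" using vec.subspace_single_0 by blast
  then have "max_dim emb G a \<in> ?S" unfolding max_dim_def using fin by (intro Max_in)
  then show "\<exists>W. vec.subspace W \<and> rankq emb G W \<le> a \<and> vec.dim W = max_dim emb G a"
    by auto
qed

lemma dimq_column_map_image:
  fixes emb :: "'q::field \<Rightarrow> 'a::{field,finite}" and G :: "'a ^ 'n::finite ^ 'k::finite"
  assumes emb: "field_embedding emb" and inj: "inj (column_map emb G)"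
  shows "dimq emb (column_map emb G ` W) = vec.dim W"
proof -
  obtain B where "finite_dimensional_vector_space (scaleq emb :: 'q \<Rightarrow> 'a ^ 'k \<Rightarrow> 'a ^ 'k) B"
    using finite_dimensional_scaleq[OF emb] by blast
  then interpret Q: finite_dimensional_vector_space "scaleq emb :: 'q \<Rightarrow> 'a ^ 'k \<Rightarrow> 'a ^ 'k" B .
  interpret P: finite_dimensional_vector_space_pair
    "(*s) :: 'q \<Rightarrow> 'q ^ 'n \<Rightarrow> 'q ^ 'n" cart_basis "scaleq emb :: 'q \<Rightarrow> 'a ^ 'k \<Rightarrow> 'a ^ 'k" B ..
  show ?thesis
    by (rule P.dim_image_eq[OF linear_column_map[OF emb] inj_on_subset[OF inj subset_UNIV]])
qed

text \<open>Each \<open>T\<close> gives the preimage of \<open>T\<close> under the column map, of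
  rank at most \<open>a\<close>. Conversely an optimal \<open>W\<close> gives any \<open>T\<close>
  of dimension \<open>a\<close> above its image. Injectivity of the column map makes the dimensions
  over the small field agree.\<close>

lemma Max_dimq_Int:
  fixes emb :: "'q::field \<Rightarrow> 'a::{field,finite}" and G :: "'a ^ 'n::finite ^ 'k::finite"
  assumes emb: "field_embedding emb" and inj: "inj (column_map emb G)" and a: "a \<le> CARD('k)"
  shows "Max {dimq emb (spanq emb (columns G) \<inter> T) | T. vec.subspace T \<and> vec.dim T = a} = max_dim emb G a"
    (is "Max ?S = _")
proof (rule Max_eqI)
  interpret vector_space "scaleq emb :: _ \<Rightarrow> 'a ^ 'k \<Rightarrow> _" by (rule vector_space_scaleq[OF emb])
  have le: "dimq emb (spanq emb (columns G) \<inter> T) \<le> max_dim emb G a"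
    if T: "vec.subspace T" "vec.dim T = a" for T
  proof -
    let ?W = "column_map emb G -` T"
    have "vec.subspace ?W"
      using T(1) by (auto simp: vec.subspace_def column_map_def emb_vec_add[OF emb] emb_vec_0[OF emb]
          emb_vec_scale[OF emb] matrix_vector_right_distrib vector_scalar_commute)
    moreover have img: "column_map emb G ` ?W = spanq emb (columns G) \<inter> T"
      by (auto simp: spanq_columns[OF emb])
    moreover have "rankq emb G ?W \<le> a"
      unfolding rankq_def img using vec.dim_subset[of "spanq emb (columns G) \<inter> T" T] T by simp
    ultimately show ?thesis
      using max_dim_ge[OF emb] dimq_column_map_image[OF emb inj] by metis
  qed
  then show "y \<le> max_dim emb G a" if "y \<in> ?S" for y using that by auto
  show "finite ?S"
    by (rule finite_subset[of _ "{..max_dim emb G a}"]) (use le in auto)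
  obtain W where W: "vec.subspace W" "rankq emb G W \<le> a" "vec.dim W = max_dim emb G a"
    using max_dim_attained[OF emb] by blast
  obtain T where T: "vec.subspace T" "column_map emb G ` W \<subseteq> T" "vec.dim T = a"
    using exists_superspace_dim[OF _ a] W(2) unfolding rankq_def by metis
  obtain B where "finite_dimensional_vector_space (scaleq emb :: 'q \<Rightarrow> 'a ^ 'k \<Rightarrow> 'a ^ 'k) B"
    using finite_dimensional_scaleq[OF emb] by blast
  then interpret Q: finite_dimensional_vector_space "scaleq emb :: 'q \<Rightarrow> 'a ^ 'k \<Rightarrow> 'a ^ 'k" B .
  have "dimq emb (column_map emb G ` W) \<le> dimq emb (spanq emb (columns G) \<inter> T)"
    using T(2) by (intro Q.dim_subset) (auto simp: spanq_columns[OF emb])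
  then have "dimq emb (spanq emb (columns G) \<inter> T) = max_dim emb G a"
    using le[OF T(1,3)] W(3) by (simp add: dimq_column_map_image[OF emb inj])
  then show "max_dim emb G a \<in> ?S" using T(1,3) by (intro CollectI exI[of _ T]) simp
qed

lemma gen_rank_weight_eq_max_dim:
  fixes emb :: "'q::field \<Rightarrow> 'a::{field,finite}" and G :: "'a ^ 'n::finite ^ 'k::finite"
  assumes emb: "field_embedding emb" and G: "generator_matrix C G" and inj: "inj (column_map emb G)"
    and r: "r \<le> CARD('k)"
  shows "gen_rank_weight TYPE('k) emb C r = CARD('n) - max_dim emb G (CARD('k) - r)"
proof -
  have "associated_system emb C (spanq emb (columns G))"
    using G by (auto simp: associated_system_def)
  moreover have "vec.dim T + r = CARD('k) \<longleftrightarrow> vec.dim T = CARD('k) - r" for T :: "('a ^ 'k) set"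
    using r by auto
  ultimately show ?thesis
    using gen_rank_weight_eq[OF emb, of C "spanq emb (columns G)" r] Max_dimq_Int[OF emb inj, of "CARD('k) - r"] by simp
qed

lemma max_defect_eq_max_dim:
  fixes emb :: "'q::field \<Rightarrow> 'a::{field,finite}" and G :: "'a ^ 'n::finite ^ 'k::finite"
  assumes emb: "field_embedding emb" and inj: "inj (column_map emb G)" and a: "a \<le> CARD('k)"
  shows "max_defect emb (spanq emb (columns G)) a = int (max_dim emb G a) - int a"
proof -
  let ?U = "spanq emb (columns G)"
  let ?S = "{dimq emb (?U \<inter> T) | T. vec.subspace T \<and> vec.dim T = a}"
  have fin: "finite ?S"
    by (rule finite_subset[of _ "(\<lambda>T. dimq emb (?U \<inter> T)) ` UNIV"]) auto
  obtain T :: "('a ^ 'k) set" where "vec.subspace T" "vec.dim T = a"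
    using exists_superspace_dim[of "{}" a] a by auto
  then have ne: "?S \<noteq> {}" by blast
  have "{defect emb ?U T | T. vec.subspace T \<and> vec.dim T = a} = (\<lambda>x. int x - int a) ` ?S"
    by (auto simp: defect_def image_iff)
  then have "max_defect emb ?U a = Max ((\<lambda>x. int x - int a) ` ?S)"
    by (simp add: max_defect_def)
  also have "\<dots> = int (Max ?S) - int a"
    by (rule mono_Max_commute[symmetric]) (use fin ne in \<open>auto simp: mono_def\<close>)
  finally show ?thesis using Max_dimq_Int[OF emb inj a] by simp
qed

section \<open>Boundary values and growth of the maximal dimension\<close>

text \<open>A space of rank 0 is mapped to 0, so injectivity leaves only the zero space. For
  \<open>C\<close> this starts the defects at 0; for the dual code it yields
  \<open>t s = k\<close>.\<close>

lemma max_dim_0: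
  fixes emb :: "'q::field \<Rightarrow> 'a::field" and G :: "'a ^ 'n::finite ^ 'k::finite"
  assumes emb: "field_embedding emb" and inj: "inj (column_map emb G)"
  shows "max_dim emb G 0 = 0"
proof -
  obtain W where W: "rankq emb G W \<le> 0" "vec.dim W = max_dim emb G 0"
    using max_dim_attained[OF emb] by blast
  then have "column_map emb G ` W \<subseteq> {0}" by (simp add: rankq_def)
  moreover have "column_map emb G 0 = 0" by (simp add: column_map_def emb_vec_0[OF emb])
  ultimately have "W \<subseteq> {0}" using inj by (auto simp: inj_def)
  then have "vec.dim W = 0" by (simp add: vec.dim_eq_0)
  then show ?thesis using W by simp
qed

lemma max_dim_full:
  fixes emb :: "'q::field \<Rightarrow> 'a::field" and G :: "'a ^ 'n::finite ^ 'k::finite"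
  assumes emb: "field_embedding emb"
  shows "max_dim emb G CARD('k) = CARD('n)"
proof (rule antisym)
  show "max_dim emb G CARD('k) \<le> CARD('n)"
    using max_dim_attained[OF emb] dim_le_card_index by metis
  have "rankq emb G UNIV \<le> CARD('k)" by (simp add: rankq_def dim_le_card_index)
  from max_dim_ge[OF emb vec.subspace_UNIV this]
  show "CARD('n) \<le> max_dim emb G CARD('k)" by (simp add: card_cart_basis)
qed

text \<open>One vector outside an optimal \<open>W\<close> raises the dimension by one and the rank
  by at most one. Hence the maximum defects never decrease.\<close>

lemma max_dim_Suc:
  fixes emb :: "'q::field \<Rightarrow> 'a::field" and G :: "'a ^ 'n::finite ^ 'k::finite"
  assumes emb: "field_embedding emb" and G: "generator_matrix C G" and a: "a < vec.dim C"
  shows "max_dim emb G a < max_dim emb G (Suc a)"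
proof -
  obtain W where W: "vec.subspace W" "rankq emb G W \<le> a" "vec.dim W = max_dim emb G a"
    using max_dim_attained[OF emb] by blast
  have "vec.span (emb_vec emb ` UNIV) = (UNIV :: ('a ^ 'n) set)"
    by (metis dim_emb_vec_image[OF emb] vec.dim_UNIV vec.dim_eq_full vec.dimension_def card_cart_basis)
  then have "rankq emb G UNIV + vec.dim (dual_code C) = CARD('n)"
    using rankq_dual_Int[OF emb G, of UNIV] by (simp add: card_cart_basis)
  \<comment> \<open>The whole space has rank \<open>vec.dim C\<close>, which exceeds
    \<open>a\<close>.\<close>
  then have "W \<noteq> UNIV" using W(2) a dim_dual_code[of C] by auto
  then obtain x where x: "x \<notin> W" by blast
  let ?W = "vec.span (insert x W)"
  have dim: "vec.dim ?W = Suc (vec.dim W)"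
    using x vec.span_eq_iff[THEN iffD2, OF W(1)] vec.dim_insert[of x W] by (simp only: vec.dim_span) simp
  have "emb_vec emb ` ?W \<subseteq> vec.span (emb_vec emb ` insert x W)" by (rule emb_vec_span[OF emb])
  then have "column_map emb G ` ?W \<subseteq> (*v) G ` vec.span (emb_vec emb ` insert x W)"
    by (auto simp: column_map_def)
  also have "\<dots> = vec.span (insert (column_map emb G x) (column_map emb G ` W))"
    by (simp add: column_map_def image_image flip: vec.span_image)
  finally have "rankq emb G ?W \<le> vec.dim (insert (column_map emb G x) (column_map emb G ` W))"
    unfolding rankq_def by (rule vec.dim_mono)
  also have "\<dots> \<le> Suc a" using W(2) by (simp add: vec.dim_insert rankq_def)
  finally have "vec.dim ?W \<le> max_dim emb G (Suc a)" by (intro max_dim_ge[OF emb]) auto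
  then show ?thesis using dim W(3) by simp
qed

section \<open>Duality of the maximal dimensions\<close>

text \<open>By \<open>rankq_dual\<close>, \<open>W\<close> has dual rank at most
  \<open>n - k - r\<close> exactly if its dual \<open>V\<close> satisfies
  \<open>dim V \<ge> \<rho>(V) + r\<close>. A largest \<open>W\<close> thus corresponds to a
  smallest such \<open>V\<close>, whose dimension is \<open>r + t\<close> for the least
  \<open>t\<close> with \<open>F(t) \<ge> t + r\<close>.\<close>

lemma max_dim_dual:
  fixes emb :: "'q::field \<Rightarrow> 'a::field"
    and G :: "'a ^ 'n::finite ^ 'k::finite" and H :: "'a ^ 'n ^ 'l::finite"
  assumes emb: "field_embedding emb" and G: "generator_matrix C G"
    and H: "generator_matrix (dual_code C) H"
    and r: "vec.dim C + r \<le> CARD('n)"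
    and t: "t + r \<le> max_dim emb G t" and least: "\<And>a. a < t \<Longrightarrow> max_dim emb G a < a + r"
  shows "max_dim emb H (CARD('n) - vec.dim C - r) = CARD('n) - (r + t)"
proof (rule antisym)
  obtain V where V: "vec.subspace V" "rankq emb G V \<le> t" "vec.dim V = max_dim emb G t"
    using max_dim_attained[OF emb] by blast
  \<comment> \<open>Cutting the optimal \<open>V\<close> down to dimension \<open>r + t\<close>
    keeps the rank at most \<open>t\<close>, so dimension minus rank is still at least
    \<open>r\<close>.\<close>
  obtain V' where V': "vec.subspace V'" "V' \<subseteq> V" "vec.dim V' = r + t"
    using vec.choose_subspace_of_subspace[of "r + t" V] t V by (metis add.commute vec.span_eq_iff)
  have "rankq emb G V' \<le> t"
    using V(2) vec.dim_subset[OF image_mono[OF V'(2)], of "column_map emb G"] by (simp add: rankq_def)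
  then have "rankq emb H (dual_code V') \<le> CARD('n) - vec.dim C - r"
    using rankq_dual[OF emb G H, of "dual_code V'"] V' dim_dual_code[of V'] by (simp add: dual_dual_code)
  from max_dim_ge[OF emb subspace_dual_code this]
  show "CARD('n) - (r + t) \<le> max_dim emb H (CARD('n) - vec.dim C - r)"
    using V'(3) dim_dual_code[of V'] by simp
next
  obtain W where W: "vec.subspace W" "rankq emb H W \<le> CARD('n) - vec.dim C - r"
      "vec.dim W = max_dim emb H (CARD('n) - vec.dim C - r)"
    using max_dim_attained[OF emb] by blast
  let ?a = "rankq emb G (dual_code W)"
  \<comment> \<open>The dual of \<open>W\<close> witnesses \<open>F(a) \<ge> a + r\<close> at its
    own rank \<open>?a\<close>, so minimality of \<open>t\<close> bounds \<open>?a\<close> from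
    below.\<close>
  have "?a + r \<le> vec.dim (dual_code W)"
    using rankq_dual[OF emb G H, of W] W(2) r dim_dual_code[of W] by linarith
  moreover from this have "?a + r \<le> max_dim emb G ?a"
    using max_dim_ge[OF emb subspace_dual_code[of W] order_refl, of G] by linarith
  then have "t \<le> ?a" using least[of ?a] by (meson leD leI)
  ultimately show "max_dim emb H (CARD('n) - vec.dim C - r) \<le> CARD('n) - (r + t)"
    using W(3) dim_dual_code[of W] by linarith
qed

section \<open>Combinatorics of step functions\<close>

text \<open>Locates an argument between consecutive jumps: with \<open>t\<close> for the weights of
  the code, with \<open>e\<close> for those of its dual.\<close>

lemma nat_between_consecutive:
  fixes f :: "nat \<Rightarrow> nat"
  assumes "f 0 \<le> a" "a < f s"
  shows "\<exists>i<s. f i \<le> a \<and> a < f (Suc i)"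
  using assms(2)
proof (induction s)
  case (Suc s)
  then show ?case by (cases "a < f s") (auto simp: less_Suc_eq)
qed (use assms(1) in simp)

text \<open>The sum \<open>e + t\<close> climbs a staircase from 0 to \<open>e s + t s\<close>. In
  stage \<open>i\<close> first \<open>t\<close> grows with \<open>e i\<close> fixed, which sweeps
  the interval of the first union, and then \<open>e\<close> grows with \<open>t (Suc i)\<close>
  fixed, which sweeps the interval of the second. Every number is passed once.\<close>

lemma complementary_interval_unions:
  fixes t e :: "nat \<Rightarrow> nat"
  assumes "\<And>i. i < s \<Longrightarrow> t i \<le> t (Suc i)" "\<And>i. i < s \<Longrightarrow> e i \<le> e (Suc i)" "t 0 = 0" "e 0 = 0"
  shows "(\<Union>i<s. {1 + e i + t i..t (Suc i) + e i}) \<subseteq> {1..e s + t s} \<and>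
    (\<Union>j\<in>{1..s}. {1 + e (j - 1) + t j..e j + t j}) =
      {1..e s + t s} - (\<Union>i<s. {1 + e i + t i..t (Suc i) + e i})"
  using assms(1,2)
proof (induction s)
  case 0
  then show ?case using assms(3,4) by simp
next
  case (Suc s)
  let ?I = "\<lambda>s. \<Union>i<s. {1 + e i + t i..t (Suc i) + e i}"
  let ?J = "\<lambda>s. \<Union>j\<in>{1..s}. {1 + e (j - 1) + t j..e j + t j}"
  have IH: "?I s \<subseteq> {1..e s + t s}" "?J s = {1..e s + t s} - ?I s"
    using Suc by auto
  have I: "?I (Suc s) = ?I s \<union> {1 + e s + t s..t (Suc s) + e s}"
    by (simp add: lessThan_Suc Un_commute)
  have J: "?J (Suc s) = ?J s \<union> {1 + e s + t (Suc s)..e (Suc s) + t (Suc s)}"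
    by (simp add: atLeastAtMostSuc_conv Un_commute)
  have le: "t s \<le> t (Suc s)" "e s \<le> e (Suc s)" using Suc.prems by auto
  have sub: "?I (Suc s) \<subseteq> {1..t (Suc s) + e s}"
    unfolding I using IH(1) le by (force simp: subset_iff)
  \<comment> \<open>The new interval of the first union fills exactly the range above
    \<open>e s + t s\<close>, so the complement does not change.\<close>
  have "{1..t (Suc s) + e s} - ?I (Suc s) = ?J s"
    unfolding I IH(2) using IH(1) le by (auto simp: not_le)
  moreover have "{1..e (Suc s) + t (Suc s)} =
      {1..t (Suc s) + e s} \<union> {1 + e s + t (Suc s)..e (Suc s) + t (Suc s)}"
    using le by auto
  ultimately have "?J (Suc s) = {1..e (Suc s) + t (Suc s)} - ?I (Suc s)"
    unfolding J using sub by auto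
  moreover have "?I (Suc s) \<subseteq> {1..e (Suc s) + t (Suc s)}"
    using sub le by (force simp: subset_iff)
  ultimately show ?case by blast
qed

text \<open>\<open>D\<close> stands for the maximum defect as a function into the naturals. Being
  nondecreasing with positive values exactly \<open>e 1, \<dots>, e s\<close>, it can only take one
  of the values \<open>e 0, \<dots>, e i\<close> before \<open>t (Suc i)\<close>, where
  \<open>e (Suc i)\<close> first occurs.\<close>

lemma jump_sequence:
  fixes D t e :: "nat \<Rightarrow> nat"
  assumes D0: "D 0 = 0" and Dk: "0 < D k" and D_mono: "mono_on {..k} D"
    and t0: "t 0 = 0" and e0: "e 0 = 0" and e: "strict_mono_on {0..s} e"
    and img: "e ` {1..s} = {D r | r. r \<le> k \<and> 0 < D r}"
    and t: "\<forall>i\<in>{1..s}. t i = (LEAST r. r \<le> k \<and> D r = e i)"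
  shows "0 < s" "e s = D k"
    and "\<And>i. i \<le> s \<Longrightarrow> t i \<le> k \<and> D (t i) = e i"
    and "\<And>i a. i < s \<Longrightarrow> a < t (Suc i) \<Longrightarrow> D a \<le> e i"
    and "\<And>i. i < s \<Longrightarrow> e i < e (Suc i) \<and> t i < t (Suc i)"
proof -
  have mono: "D a \<le> D b" if "a \<le> b" "b \<le> k" for a b
    using monotone_onD[OF D_mono] that by simp
  have "D k \<in> e ` {1..s}" using img Dk by auto
  then obtain l where l: "l \<in> {1..s}" "e l = D k" by auto
  then show s: "0 < s" by simp
  have e_less: "e i < e j" if "i < j" "j \<le> s" for i j
    using e that by (auto simp: strict_mono_on_def)
  have attained: "\<exists>r. r \<le> k \<and> D r = e i" if "i \<le> s" for i
  proof (cases "i = 0")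
    case False
    then have "e i \<in> {D r | r. r \<le> k \<and> 0 < D r}" using that by (simp flip: img)
    then show ?thesis by auto
  qed (use D0 e0 in auto)
  have "e s \<le> D k" using attained[of s] mono[of _ k] by (metis order_refl)
  moreover have "e l \<le> e s" using l e_less[of l s] by (cases "l = s") auto
  ultimately show "e s = D k" using l by simp
  show Dt: "t i \<le> k \<and> D (t i) = e i" if "i \<le> s" for i
  proof (cases "i = 0")
    case False
    then show ?thesis using LeastI_ex[OF attained[OF that]] t that by auto
  qed (use t0 e0 D0 in auto)
  show below: "D a \<le> e i" if "i < s" "a < t (Suc i)" for i a
  proof (cases "D a = 0")
    case False
    have ti: "t (Suc i) = (LEAST r. r \<le> k \<and> D r = e (Suc i))" using t that by simp
    have "t (Suc i) \<le> k" "D (t (Suc i)) = e (Suc i)" using Dt[of "Suc i"] that by auto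
    then have ak: "a \<le> k" and le: "D a \<le> e (Suc i)" using mono[of a "t (Suc i)"] that by auto
    \<comment> \<open>\<open>a\<close> lies before the first index at which \<open>e (Suc i)\<close>
      is attained; with \<open>le\<close>, only smaller values remain.\<close>
    have ne: "D a \<noteq> e (Suc i)" using not_less_Least[of a "\<lambda>r. r \<le> k \<and> D r = e (Suc i)"] that ti ak by auto
    have "D a \<in> e ` {1..s}" using img False ak by auto
    then obtain j where j: "j \<in> {1..s}" "D a = e j" by auto
    have "j < Suc i"
    proof (rule ccontr)
      assume "\<not> j < Suc i"
      then have "e (Suc i) \<le> e j" using j e_less[of "Suc i" j] by (cases "j = Suc i") auto
      with le ne j show False by simp
    qed
    then show ?thesis using j e_less[of j i] that by (cases "j = i") auto
  qed simp
  show "e i < e (Suc i) \<and> t i < t (Suc i)" if "i < s" for i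
  proof -
    have "e i < e (Suc i)" using e_less that by simp
    moreover have "t i < t (Suc i)"
    proof (rule ccontr)
      assume "\<not> t i < t (Suc i)"
      then have "D (t (Suc i)) \<le> D (t i)" using Dt[of i] that by (intro mono) auto
      with Dt[of i] Dt[of "Suc i"] that \<open>e i < e (Suc i)\<close> show False by simp
    qed
    ultimately show ?thesis ..
  qed
qed

section \<open>The weight hierarchies of a code and its dual\<close>

theorem theorem2p14:
  fixes emb :: "'q::{field,finite} \<Rightarrow> 'a::{field,finite}"
    and C :: "('a ^ 'n::finite) set"
    and U :: "('a ^ 'k::finite) set"
    and n k s :: nat
    and t e :: "nat \<Rightarrow> nat"
  assumes "field_embedding emb"
    and "k = CARD('k)"
    and "n - k = CARD('l::finite)"
    and "linear_code n k C"
    and "nondegenerate TYPE('k) emb C"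
    and "nondegenerate TYPE('l) emb (dual_code C)"
    and "associated_system emb C U"
    and "max_defect_sequence emb U s t e"
  shows
    "let d = gen_rank_weight TYPE('k) emb C;
         d' = gen_rank_weight TYPE('l) emb (dual_code C)
     in
     t s = k \<and> e s = n - k \<and>
     (\<forall>r\<in>{1..k}. \<forall>i<s. t i \<le> k - r \<and> k - r < t (Suc i) \<longrightarrow>
        int (d r) = int n - (int k - int r) - int (e i)) \<and>
     (\<lambda>r. n + 1 - d r) ` {1..k} = (\<Union>i<s. {1 + e i + t i..t (Suc i) + e i}) \<and>
     (\<forall>r\<in>{1..n - k}. \<forall>j\<in>{1..s}. e (j - 1) < r \<and> r \<le> e j \<longrightarrow> d' r = r + t j) \<and>
     d' ` {1..n - k} = (\<Union>j\<in>{1..s}. {1 + e (j - 1) + t j..e j + t j}) \<and>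
     d' ` {1..n - k} = {1..n} - (\<lambda>r. n + 1 - d r) ` {1..k}"
proof -
  note emb = assms(1)
  have n: "n = CARD('n)" and dimC: "vec.dim C = k"
    using assms(4) by (auto simp: linear_code_def)
  have nk: "k < n" using assms(3) zero_less_card_finite[where 'a = 'l] by linarith
  obtain G :: "'a ^ 'n ^ 'k" where G: "generator_matrix C G" and U: "U = spanq emb (columns G)"
    using assms(7) by (auto simp: associated_system_def)
  obtain H :: "'a ^ 'n ^ 'l" where H: "generator_matrix (dual_code C) H"
    using assms(6) by (auto simp: nondegenerate_def)
  note injG = nondegenerate_inj_column_map[OF emb assms(5) G]
  note injH = nondegenerate_inj_column_map[OF emb assms(6) H]
  let ?F = "max_dim emb G"
  \<comment> \<open>The subtraction is on naturals. That it truncates nothing up to \<open>k\<close>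
    is the content of \<open>F\<close>, so there \<open>D\<close> is the maximum defect.\<close>
  define D where "D a = ?F a - a" for a
  have F_Suc: "?F a < ?F (Suc a)" if "a < k" for a
    using max_dim_Suc[OF emb G] that dimC by simp
  have F: "?F a = D a + a" if "a \<le> k" for a
  proof -
    have "a \<le> ?F a" using that
    proof (induction a)
      case (Suc a)
      then show ?case using F_Suc[of a] by simp
    qed simp
    then show ?thesis by (simp add: D_def)
  qed
  \<comment> \<open>\<open>?F\<close> gains at least one at each step, which makes up for the growth
    of the subtracted index.\<close>
  have D_mono: "D a \<le> D b" if "a \<le> b" "b \<le> k" for a b
    using that
  proof (induction b rule: dec_induct)
    case (step b)
    then show ?case using F_Suc[of b] F[of b] F[of "Suc b"] by simp
  qed simp
  have D0: "D 0 = 0" by (simp add: D_def max_dim_0[OF emb injG])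
  have Dk: "D k = n - k" by (simp add: D_def max_dim_full[OF emb] assms(2) n)
  have defect: "max_defect emb U r = int (D r)" if "r \<le> k" for r
    using max_defect_eq_max_dim[OF emb injG, of r] F[OF that] that by (simp add: U assms(2))
  have seq: "t 0 = 0" "e 0 = 0" "strict_mono_on {0..s} e"
    and img: "(\<lambda>i. int (e i)) ` {1..s} =
       {max_defect emb U r | r. r \<le> k \<and> 0 < max_defect emb U r}"
    and t: "\<And>i. i \<in> {1..s} \<Longrightarrow> t i = (LEAST r. r \<le> k \<and> max_defect emb U r = int (e i))"
    using assms(8) by (auto simp: max_defect_sequence_def assms(2))
  have "int ` e ` {1..s} = int ` {D r | r. r \<le> k \<and> 0 < D r}"
    unfolding image_image img by (force simp: defect)
  then have img': "e ` {1..s} = {D r | r. r \<le> k \<and> 0 < D r}"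
    by (simp only: inj_image_eq_iff[OF inj_of_nat])
  have t': "\<forall>i\<in>{1..s}. t i = (LEAST r. r \<le> k \<and> D r = e i)"
    using t by (simp add: defect cong: conj_cong)
  have D_pos: "0 < D k" using Dk nk by simp
  have "mono_on {..k} D" by (auto intro!: monotone_onI D_mono)
  note jumps = jump_sequence[OF D0 D_pos this seq img' t']
  have d: "gen_rank_weight TYPE('k) emb C r = n - (D (k - r) + (k - r))" if "r \<in> {1..k}" for r
    using gen_rank_weight_eq_max_dim[OF emb G injG, of r] F[of "k - r"] that by (simp add: assms(2) n)
  \<comment> \<open>When \<open>e (j - 1) < r \<le> e j\<close>, the index \<open>t j\<close> is the
    first at which the defect reaches \<open>r\<close>, as \<open>max_dim_dual\<close>
    requires.\<close>
  have H_dual: "max_dim emb H (n - k - r) = n - (r + t j)"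
    if "j \<in> {1..s}" "e (j - 1) < r" "r \<le> e j" for r j
  proof -
    have j: "j - 1 < s" "Suc (j - 1) = j" "j \<le> s" using that by auto
    have tj: "t j \<le> k" "D (t j) = e j" using jumps(3)[OF j(3)] by auto
    have "e j \<le> D k" using D_mono[of "t j" k] tj by simp
    then have "vec.dim C + r \<le> CARD('n)" using that(3) Dk nk dimC n by simp
    moreover have "t j + r \<le> ?F (t j)" using F[OF tj(1)] tj(2) that(3) by simp
    moreover have "?F a < a + r" if "a < t j" for a
      using jumps(4)[OF j(1), of a] that \<open>e (j - 1) < r\<close> F[of a] j(2) tj(1) by simp
    ultimately show ?thesis using max_dim_dual[OF emb G H, of r "t j"] by (simp add: dimC n)
  qed
  have d': "gen_rank_weight TYPE('l) emb (dual_code C) r = r + t j"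
    if "r \<in> {1..n - k}" "j \<in> {1..s}" "e (j - 1) < r" "r \<le> e j" for r j
  proof -
    have "t j \<le> k" using jumps(3)[of j] that(2) by simp
    then have "r + t j \<le> n" using that(1) nk by auto
    then show ?thesis
      using gen_rank_weight_eq_max_dim[OF emb H injH, of r] H_dual[OF that(2-4)] that(1)
      by (simp add: assms(3)[symmetric] n)
  qed
  have es: "e s = n - k" using jumps(2) Dk by simp
  have ts: "t s = k"
  proof -
    \<comment> \<open>The left side is 0, so the truncated difference only says
      \<open>k \<le> t s\<close>; the reverse inequality comes from \<open>jumps(3)\<close>.\<close>
    have "max_dim emb H (n - k - (n - k)) = n - (n - k + t s)"
      using H_dual[of s "n - k"] jumps(1) jumps(5)[of "s - 1"] es nk by simp
    then show ?thesis using max_dim_0[OF emb injH] jumps(3)[of s] nk by simp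
  qed
  have D_between: "D a = e i" if "i < s" "t i \<le> a" "a < t (Suc i)" for i a
  proof (rule antisym)
    show "D a \<le> e i" using jumps(4) that by simp
    have "a \<le> k" using that jumps(3)[of "Suc i"] by simp
    then show "e i \<le> D a" using D_mono[OF that(2)] jumps(3)[of i] that(1) by simp
  qed
  let ?d = "gen_rank_weight TYPE('k) emb C"
  let ?d' = "gen_rank_weight TYPE('l) emb (dual_code C)"
  \<comment> \<open>Rules out truncation when \<open>d\<close> is turned into
    \<open>n + 1 - d r = 1 + D (k - r) + (k - r)\<close>.\<close>
  have bound: "D (k - r) + (k - r) \<le> n" for r
    using D_mono[of "k - r" k] Dk nk by simp
  have part1: "int (?d r) = int n - (int k - int r) - int (e i)"
    if "r \<in> {1..k}" "i < s" "t i \<le> k - r" "k - r < t (Suc i)" for r i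
    using d[OF that(1)] D_between[OF that(2-4)] bound[of r] that(1) by auto
  have image1: "(\<lambda>r. n + 1 - ?d r) ` {1..k} = (\<Union>i<s. {1 + e i + t i..t (Suc i) + e i})"
  proof (intro subset_antisym subsetI)
    fix x assume "x \<in> (\<lambda>r. n + 1 - ?d r) ` {1..k}"
    then obtain r where r: "r \<in> {1..k}" "x = n + 1 - ?d r" by auto
    obtain i where i: "i < s" "t i \<le> k - r" "k - r < t (Suc i)"
      using nat_between_consecutive[of t "k - r" s] seq(1) ts r(1) by auto
    have "x = 1 + (e i + (k - r))" using r d[OF r(1)] D_between[OF i] bound[of r] by auto
    then show "x \<in> (\<Union>i<s. {1 + e i + t i..t (Suc i) + e i})" using i by (intro UN_I[of i]) auto
  next
    fix x assume "x \<in> (\<Union>i<s. {1 + e i + t i..t (Suc i) + e i})"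
    then obtain i where i: "i < s" "1 + e i + t i \<le> x" "x \<le> t (Suc i) + e i" by auto
    \<comment> \<open>Inverts \<open>x = 1 + e i + a\<close>; the weight index is then
      \<open>r = k - a\<close>.\<close>
    define a where "a = x - 1 - e i"
    have a: "t i \<le> a" "a < t (Suc i)" "x = 1 + (e i + a)" using i by (auto simp: a_def)
    have "a < k" using a(2) jumps(3)[of "Suc i"] i(1) by simp
    then have r: "k - a \<in> {1..k}" "k - (k - a) = a" by auto
    then have "x = n + 1 - ?d (k - a)"
      using d[OF r(1)] D_between[OF i(1) a(1,2)] a(3) bound[of "k - a"] by simp
    then show "x \<in> (\<lambda>r. n + 1 - ?d r) ` {1..k}" using r(1) by blast
  qed
  have image2: "?d' ` {1..n - k} = (\<Union>j\<in>{1..s}. {1 + e (j - 1) + t j..e j + t j})"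
  proof (intro subset_antisym subsetI)
    fix x assume "x \<in> ?d' ` {1..n - k}"
    then obtain r where r: "r \<in> {1..n - k}" "x = ?d' r" by auto
    \<comment> \<open>The shift by one turns the half-open range
      \<open>e i \<le> r - 1 < e (Suc i)\<close> into \<open>e (j - 1) < r \<le> e j\<close> for
      \<open>j = Suc i\<close>.\<close>
    have "r - 1 < e s" using r(1) es by auto
    then obtain i where i: "i < s" "e i \<le> r - 1" "r - 1 < e (Suc i)"
      using nat_between_consecutive[of e "r - 1" s] seq(2) by auto
    then have "e (Suc i - 1) < r" "r \<le> e (Suc i)" "Suc i \<in> {1..s}" using r(1) by auto
    moreover from this have "x = r + t (Suc i)" using r d' by blast
    ultimately show "x \<in> (\<Union>j\<in>{1..s}. {1 + e (j - 1) + t j..e j + t j})"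
      by (intro UN_I[of "Suc i"]) auto
  next
    fix x assume "x \<in> (\<Union>j\<in>{1..s}. {1 + e (j - 1) + t j..e j + t j})"
    then obtain j where j: "j \<in> {1..s}" "1 + e (j - 1) + t j \<le> x" "x \<le> e j + t j" by auto
    have "e j \<le> n - k" using jumps(3)[of j] D_mono[of "t j" k] Dk j(1) by auto
    then have r: "x - t j \<in> {1..n - k}" using j by auto
    have "?d' (x - t j) = x" using d'[OF r j(1)] j by simp
    then show "x \<in> ?d' ` {1..n - k}" using r by (metis imageI)
  qed
  \<comment> \<open>The staircase ends at \<open>e s + t s = (n - k) + k = n\<close>.\<close>
  have "(\<Union>j\<in>{1..s}. {1 + e (j - 1) + t j..e j + t j}) =
      {1..n} - (\<Union>i<s. {1 + e i + t i..t (Suc i) + e i})"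
    using complementary_interval_unions[of s t e] jumps(5) seq(1,2) es ts nk by (simp add: less_imp_le)
  then have part3: "?d' ` {1..n - k} = {1..n} - (\<lambda>r. n + 1 - ?d r) ` {1..k}"
    unfolding image1 image2 .
  show ?thesis
    unfolding Let_def
    by (intro conjI ballI allI impI ts es image1 image2 part3) (auto simp: part1 d')
qed

end
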